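(* Let $D$ be a diagram containing no ghost cells, i.e. $|G(D)|=0$, and let $M=\max\{|G(T)| : T\in \mathrm{GKD}(D)\}$. Then the ghost Kohnert poset $\mathcal{P}_G(D)$ is ranked, and the function $\rho(T)=M-|G(T)|$ for $T\in\mathcal{P}_G(D)$ is a rank function for it.
   Context: A diagram is a finite set of cells placed at positions $(r,c)\in\mathbb{Z}_{>0}\times\mathbb{Z}_{>0}$ ($r$ the row, counted from the bottom; $c$ the column), each position holding at most one cell; each cell is either an ordinary cell, written $(r,c)$, or a ghost cell, written $\langle r,c\rangle$. A position is empty if it holds no cell of either kind. $G(D)$ denotes the set of ghost cells of $D$. The ghost move at row $r$ of $D$, with result denoted $\mathcal{G}(D,r)$, is defined as follows: if row $r$ is empty, $\mathcal{G}(D,r)=D$. Otherwise let $c$ be the largest column of a cell in row $r$ (the rightmost cell of the row). If this rightmost cell is a ghost cell, or there is no empty position $(\hat r,c)$ with $\hat r<r$, or, letting $\hat r<r$ be maximal with $(\hat r,c)$ empty, there is a ghost cell $\langle r^*,c\rangle$ with $\hat r<r^*<r$, then $\mathcal{G}(D,r)=D$. Otherwise, with $\hat r<r$ maximal such that $(\hat r,c)$ is empty, $\mathcal{G}(D,r)=(D\setminus\{(r,c)\})\cup\{(\hat r,c),\langle r,c\rangle\}$ (the cell drops to the highest empty position below it in its column and leaves a ghost cell in its old place). $\mathrm{GKD}(D)$ is the set of all diagrams obtainable from $D$ by finite (possibly empty) sequences of ghost moves. The ghost Kohnert poset $\mathcal{P}_G(D)$ has underlying set $\mathrm{GKD}(D)$,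 with $D_2\preceq D_1$ iff $D_2$ can be obtained from $D_1$ by a finite (possibly empty) sequence of ghost moves. A finite poset is ranked if there is $\rho:\mathcal{P}\to\mathbb{Z}_{\ge0}$ with $\rho(x)<\rho(y)$ whenever $x\prec y$ and $\rho(y)=\rho(x)+1$ whenever $y$ covers $x$. *)

theory Defs
  imports Main
begin

text \<open>Both arguments are row first, then column; rows are counted from the bottom.\<close>

datatype cell = Cell nat nat | Ghost nat nat

definition occupied :: "cell set \<Rightarrow> nat \<Rightarrow> nat \<Rightarrow> bool" where
  "occupied D r c \<longleftrightarrow> Cell r c \<in> D \<or> Ghost r c \<in> D"

definition diagram :: "cell set \<Rightarrow> bool" where
  "diagram D \<longleftrightarrow> finite D
     \<and> (\<forall>r c. occupied D r c \<longrightarrow> r > 0 \<and> c > 0)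
     \<and> (\<forall>r c. \<not> (Cell r c \<in> D \<and> Ghost r c \<in> D))"

definition ghosts :: "cell set \<Rightarrow> cell set" where
  "ghosts D = {x \<in> D. \<exists>r c. x = Ghost r c}"

text \<open>Positions start at row 1, so row 0 is excluded from the empty positions below.\<close>

definition empty_below :: "cell set \<Rightarrow> nat \<Rightarrow> nat \<Rightarrow> nat set" where
  "empty_below D r c = {s. 0 < s \<and> s < r \<and> \<not> occupied D s c}"

definition ghost_move :: "cell set \<Rightarrow> nat \<Rightarrow> cell set" where
  "ghost_move D r =
    (if \<forall>c. \<not> occupied D r c then D
     else let c = Max {c. occupied D r c}; E = empty_below D r c in
       if Ghost r c \<in> D \<or> E = {} \<or> (\<exists>s. Max E < s \<and> s < r \<and> Ghost s c \<in> D) then D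
       else (D - {Cell r c}) \<union> {Cell (Max E) c, Ghost r c})"

definition ghost_reach :: "cell set \<Rightarrow> cell set \<Rightarrow> bool" where
  "ghost_reach = (\<lambda>D D'. \<exists>r>0. D' = ghost_move D r)\<^sup>*\<^sup>*"

definition GKD :: "cell set \<Rightarrow> cell set set" where
  "GKD D = {T. ghost_reach D T}"

text \<open>The order relation of the ghost Kohnert poset on \<open>GKD D\<close>; the smaller diagram comes first.\<close>

definition ghost_le :: "cell set \<Rightarrow> cell set rel" where
  "ghost_le D = {(D2, D1). D1 \<in> GKD D \<and> D2 \<in> GKD D \<and> ghost_reach D1 D2}"

definition finite_poset :: "'a set \<Rightarrow> 'a rel \<Rightarrow> bool" where
  "finite_poset P R \<longleftrightarrow> finite P \<and> partial_order_on P R"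

definition strictly_below :: "'a rel \<Rightarrow> 'a \<Rightarrow> 'a \<Rightarrow> bool" where
  "strictly_below R x y \<longleftrightarrow> (x, y) \<in> R \<and> x \<noteq> y"

definition covers :: "'a set \<Rightarrow> 'a rel \<Rightarrow> 'a \<Rightarrow> 'a \<Rightarrow> bool" where
  "covers P R y x \<longleftrightarrow> strictly_below R x y
     \<and> \<not> (\<exists>z\<in>P. strictly_below R x z \<and> strictly_below R z y)"

text \<open>Rank functions take values in the nonnegative integers. They are rendered as \<open>int\<close>-valued
  functions with a nonnegativity condition, so that differences such as \<open>M - |G(T)|\<close> are genuine
  rather than truncated.\<close>

definition rank_function :: "'a set \<Rightarrow> 'a rel \<Rightarrow> ('a \<Rightarrow> int) \<Rightarrow> bool" where
  "rank_function P R \<rho> \<longleftrightarrow>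
     (\<forall>x\<in>P. 0 \<le> \<rho> x)
     \<and> (\<forall>x\<in>P. \<forall>y\<in>P. strictly_below R x y \<longrightarrow> \<rho> x < \<rho> y)
     \<and> (\<forall>x\<in>P. \<forall>y\<in>P. covers P R y x \<longrightarrow> \<rho> y = \<rho> x + 1)"

definition ranked :: "'a set \<Rightarrow> 'a rel \<Rightarrow> bool" where
  "ranked P R \<longleftrightarrow> finite_poset P R \<and> (\<exists>\<rho>. rank_function P R \<rho>)"

end

theory Submission
  imports Defs
begin

text \<open>Every ghost move that changes a finite diagram creates exactly one ghost cell and destroys none.
  Hence the number of ghost cells strictly increases along the order, which gives antisymmetry. If
  \<open>y\<close> covers \<open>x\<close>, the first effective move from \<open>y\<close> towards \<open>x\<close> must already yield \<open>x\<close>, so the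
  numbers of ghost cells differ by one. Moves never leave a bounding box of the initial diagram, so
  the poset is finite.\<close>

text \<open>Condenses \<open>ghost_move\<close> to what counting and bounding rely on: an effective
  move acts at an occupied position, drops to a lower row, and leaves a ghost where there was
  none.\<close>

lemma ghost_move_cases:
  assumes "finite D"
  obtains (stay) "ghost_move D r = D"
  | (drop) c s where "occupied D r c" "s < r" "Ghost r c \<notin> D"
      "ghost_move D r = (D - {Cell r c}) \<union> {Cell s c, Ghost r c}"
proof (cases "ghost_move D r = D")
  case True
  then show ?thesis by (rule stay)
next
  case False
  define c where "c = Max {c. occupied D r c}"
  define E where "E = empty_below D r c"
  have ne: "{c. occupied D r c} \<noteq> {}" and "Ghost r c \<notin> D" and "E \<noteq> {}"
    and move: "ghost_move D r = (D - {Cell r c}) \<union> {Cell (Max E) c, Ghost r c}"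
    using False by (auto simp: ghost_move_def Let_def c_def E_def split: if_splits)
  \<comment> \<open>The occupied columns of row \<open>r\<close> are a projection of the finite set
    \<open>D\<close>, so their \<open>Max\<close> is attained.\<close>
  have "{c. occupied D r c} \<subseteq> (\<lambda>x. case x of Cell a b \<Rightarrow> b | Ghost a b \<Rightarrow> b) ` D"
    by (force simp: occupied_def)
  then have "finite {c. occupied D r c}"
    using assms finite_surj by blast
  then have "occupied D r c"
    using Max_in[OF _ ne] by (simp add: c_def)
  moreover have "finite E"
    by (rule finite_subset[of _ "{..<r}"]) (auto simp: E_def empty_below_def)
  then have "Max E < r"
    using Max_in[OF _ \<open>E \<noteq> {}\<close>] by (auto simp: E_def empty_below_def)
  ultimately show ?thesis
    using drop \<open>Ghost r c \<notin> D\<close> move by blast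
qed

lemma finite_ghost_move: "finite D \<Longrightarrow> finite (ghost_move D r)"
  by (auto simp: ghost_move_def Let_def)

text \<open>The cell removed and the cell placed lower are both ordinary, so the ghost set gains
  exactly \<open>Ghost r c\<close>, which is new.\<close>

lemma card_ghosts_ghost_move:
  assumes "finite D" "ghost_move D r \<noteq> D"
  shows "card (ghosts (ghost_move D r)) = Suc (card (ghosts D))"
  using assms(1)
proof (cases rule: ghost_move_cases[where r = r])
  case stay
  with assms(2) show ?thesis by simp
next
  case (drop c s)
  then have "ghosts (ghost_move D r) = insert (Ghost r c) (ghosts D)"
    by (auto simp: ghosts_def)
  moreover have "finite (ghosts D)" "Ghost r c \<notin> ghosts D"
    using assms(1) drop(3) by (auto simp: ghosts_def)
  ultimately show ?thesis by simp
qed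

definition box :: "nat \<Rightarrow> cell set" where
  "box n = case_prod Cell ` ({..n} \<times> {..n}) \<union> case_prod Ghost ` ({..n} \<times> {..n})"

lemma finite_box: "finite (box n)"
  by (simp add: box_def)

lemma Cell_in_box_iff [simp]: "Cell r c \<in> box n \<longleftrightarrow> r \<le> n \<and> c \<le> n"
  and Ghost_in_box_iff [simp]: "Ghost r c \<in> box n \<longleftrightarrow> r \<le> n \<and> c \<le> n"
  by (auto simp: box_def)

lemma finite_subset_box:
  assumes "finite D"
  obtains n where "D \<subseteq> box n"
proof -
  define m where "m x = (case x of Cell r c \<Rightarrow> max r c | Ghost r c \<Rightarrow> max r c)" for x
  obtain n where n: "\<And>x. x \<in> D \<Longrightarrow> m x \<le> n"
    using finite_imageI[OF assms, of m] Max_ge by blast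
  have "x \<in> box n" if "x \<in> D" for x
    using n[OF that] by (cases x) (auto simp: m_def)
  then show ?thesis using that by blast
qed

text \<open>A move writes only in column \<open>c\<close>, at row \<open>r\<close> and a lower row,
  and position \<open>(r, c)\<close> was occupied already, so neither coordinate bound is
  exceeded.\<close>

lemma ghost_move_subset_box:
  assumes "D \<subseteq> box n"
  shows "ghost_move D r \<subseteq> box n"
  using finite_subset[OF assms finite_box]
proof (cases rule: ghost_move_cases[where r = r])
  case stay
  with assms show ?thesis by simp
next
  case (drop c s)
  have "r \<le> n" "c \<le> n"
    using drop(1) subsetD[OF assms, of "Cell r c"] subsetD[OF assms, of "Ghost r c"]
    by (auto simp: occupied_def)
  with drop assms show ?thesis by auto
qed

lemma ghost_reach_refl: "ghost_reach D D"
  by (simp add: ghost_reach_def)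

lemma ghost_reach_trans: "ghost_reach D E \<Longrightarrow> ghost_reach E F \<Longrightarrow> ghost_reach D F"
  by (simp add: ghost_reach_def)

lemma ghost_reach_ghost_move: "r > 0 \<Longrightarrow> ghost_reach D (ghost_move D r)"
  by (auto simp: ghost_reach_def)

lemma ghost_reach_subset_box:
  assumes "ghost_reach D T" "D \<subseteq> box n"
  shows "T \<subseteq> box n"
  using assms(1) unfolding ghost_reach_def
proof (induction rule: rtranclp_induct)
  case base
  show ?case by (rule assms(2))
next
  case (step E F)
  then show ?case using ghost_move_subset_box by blast
qed

lemma finite_ghost_reach:
  assumes "ghost_reach D T" "finite D"
  shows "finite T"
proof -
  obtain n where "D \<subseteq> box n"
    using assms(2) by (rule finite_subset_box)
  with assms(1) have "T \<subseteq> box n"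
    by (rule ghost_reach_subset_box)
  then show ?thesis
    using finite_box by (rule finite_subset)
qed

lemma finite_GKD:
  assumes "finite D"
  shows "finite (GKD D)"
proof -
  obtain n where "D \<subseteq> box n"
    using assms by (rule finite_subset_box)
  then have "GKD D \<subseteq> Pow (box n)"
    by (auto simp: GKD_def dest: ghost_reach_subset_box)
  then show ?thesis
    using finite_subset finite_box by blast
qed

text \<open>\<open>ghost_reach\<close> admits moves that change nothing; discarding those at the
  start of a path between distinct diagrams exposes its first effective move.\<close>

lemma ghost_reach_first_move:
  assumes "ghost_reach D T" "D \<noteq> T"
  obtains r where "r > 0" "ghost_move D r \<noteq> D" "ghost_reach (ghost_move D r) T"
proof -
  have "D = T \<or> (\<exists>r>0. ghost_move D r \<noteq> D \<and> ghost_reach (ghost_move D r) T)"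
    using assms(1) unfolding ghost_reach_def
  proof (induction rule: converse_rtranclp_induct)
    case base
    show ?case by simp
  next
    case (step D E)
    then obtain r where r: "r > 0" "E = ghost_move D r" by blast
    show ?case
    proof (cases "E = D")
      case True
      with step.IH show ?thesis by simp
    next
      case False
      with r step.hyps(2) show ?thesis by blast
    qed
  qed
  then show ?thesis
    using assms(2) that by blast
qed

lemma card_ghosts_mono:
  assumes "ghost_reach D T" "finite D"
  shows "card (ghosts D) \<le> card (ghosts T)"
proof -
  \<comment> \<open>Finiteness is carried through the induction because counting the ghosts added by
    the next move requires it.\<close>
  have "finite T \<and> card (ghosts D) \<le> card (ghosts T)"
    using assms(1) unfolding ghost_reach_def
  proof (induction rule: rtranclp_induct)
    case base
    show ?case using assms(2) by simp
  next
    case (step E F)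
    then obtain r where "F = ghost_move E r" by blast
    then show ?case
      using step.IH card_ghosts_ghost_move[of E r] finite_ghost_move[of E r]
      by (cases "ghost_move E r = E") auto
  qed
  then show ?thesis ..
qed

text \<open>The first effective move adds a ghost, and the remaining moves lose none.\<close>

lemma card_ghosts_strict_mono:
  assumes "ghost_reach D T" "D \<noteq> T" "finite D"
  shows "card (ghosts D) < card (ghosts T)"
proof -
  obtain r where r: "ghost_move D r \<noteq> D" "ghost_reach (ghost_move D r) T"
    using assms(1,2) by (rule ghost_reach_first_move)
  show ?thesis
    using card_ghosts_ghost_move[OF assms(3) r(1)]
      card_ghosts_mono[OF r(2) finite_ghost_move[OF assms(3)]] by simp
qed

lemma partial_order_ghost_le:
  assumes "finite D"
  shows "partial_order_on (GKD D) (ghost_le D)"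
proof -
  have "refl_on (GKD D) (ghost_le D)"
    by (auto simp: refl_on_def ghost_le_def ghost_reach_refl)
  moreover have "trans (ghost_le D)"
    by (auto simp: trans_def ghost_le_def intro: ghost_reach_trans)
  moreover have "antisym (ghost_le D)"
  proof (rule antisymI)
    fix x y
    assume "(x, y) \<in> ghost_le D" "(y, x) \<in> ghost_le D"
    then have "finite x" "finite y" "ghost_reach x y" "ghost_reach y x"
      using assms by (auto simp: ghost_le_def GKD_def dest: finite_ghost_reach)
    then show "x = y"
      \<comment> \<open>If \<open>x\<close> and \<open>y\<close> differed, each would have strictly
        more ghosts than the other.\<close>
      using card_ghosts_strict_mono[of x y] card_ghosts_strict_mono[of y x] by force
  qed
  moreover have "ghost_le D \<subseteq> GKD D \<times> GKD D"
    by (auto simp: ghost_le_def)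
  ultimately show ?thesis
    by (simp add: partial_order_on_def preorder_on_def)
qed

text \<open>The diagram after the first effective move from \<open>y\<close> lies weakly above
  \<open>x\<close> and strictly below \<open>y\<close>; the cover leaves no room between them, so it
  equals \<open>x\<close>.\<close>

lemma covers_ghost_le_imp_ghost_move:
  assumes "covers (GKD D) (ghost_le D) y x" "finite D"
  obtains r where "x = ghost_move y r" "ghost_move y r \<noteq> y"
proof -
  have y: "y \<in> GKD D" and x: "x \<in> GKD D" and "ghost_reach y x" "y \<noteq> x"
    using assms(1) by (auto simp: covers_def strictly_below_def ghost_le_def)
  from this(3,4) obtain r
    where r: "r > 0" "ghost_move y r \<noteq> y" "ghost_reach (ghost_move y r) x"
    by (rule ghost_reach_first_move)
  have "ghost_reach y (ghost_move y r)"
    using r(1) by (rule ghost_reach_ghost_move)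
  moreover from this have z: "ghost_move y r \<in> GKD D"
    using y by (auto simp: GKD_def intro: ghost_reach_trans)
  ultimately have "strictly_below (ghost_le D) (ghost_move y r) y"
    using y r(2) by (simp add: strictly_below_def ghost_le_def)
  then have "\<not> strictly_below (ghost_le D) x (ghost_move y r)"
    using assms(1) z by (auto simp: covers_def)
  then have "x = ghost_move y r"
    using x z r(3) by (simp add: strictly_below_def ghost_le_def)
  from this r(2) show ?thesis by (rule that)
qed

theorem theorem3p2:
  fixes D :: "cell set" and M :: nat
  assumes "diagram D"
    and "card (ghosts D) = 0"
    and "M = Max ((\<lambda>T. card (ghosts T)) ` GKD D)"
  shows "ranked (GKD D) (ghost_le D)
    \<and> rank_function (GKD D) (ghost_le D) (\<lambda>T. int M - int (card (ghosts T)))"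
proof -
  have fin: "finite D"
    using assms(1) by (simp add: diagram_def)
  have finT: "finite T" if "T \<in> GKD D" for T
    using that fin finite_ghost_reach by (auto simp: GKD_def)
  have "rank_function (GKD D) (ghost_le D) (\<lambda>T. int M - int (card (ghosts T)))"
    unfolding rank_function_def
  proof (intro conjI ballI impI)
    fix x assume "x \<in> GKD D"
    \<comment> \<open>\<open>M\<close> is the maximum over the finite set of ghost counts, to which
      the count of \<open>x\<close> belongs.\<close>
    then show "0 \<le> int M - int (card (ghosts x))"
      using finite_GKD[OF fin] by (simp add: assms(3))
  next
    fix x y assume "y \<in> GKD D" "strictly_below (ghost_le D) x y"
    \<comment> \<open>Lower diagrams are reached from higher ones, so \<open>x\<close> has more
      ghosts than \<open>y\<close>; subtracting from \<open>M\<close> reverses the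
      inequality.\<close>
    then show "int M - int (card (ghosts x)) < int M - int (card (ghosts y))"
      using card_ghosts_strict_mono[of y x] finT[of y]
      by (auto simp: strictly_below_def ghost_le_def)
  next
    fix x y assume y: "y \<in> GKD D" and "covers (GKD D) (ghost_le D) y x"
    from this(2) fin obtain r where "x = ghost_move y r" "ghost_move y r \<noteq> y"
      by (rule covers_ghost_le_imp_ghost_move)
    then show "int M - int (card (ghosts y)) = int M - int (card (ghosts x)) + 1"
      using card_ghosts_ghost_move[OF finT[OF y]] by simp
  qed
  then show ?thesis
    using finite_GKD[OF fin] partial_order_ghost_le[OF fin]
    by (auto simp: ranked_def finite_poset_def)
qed

end
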